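(* Suppose that $R$ is a prime rich ring, $\mathfrak{a}$ is an ideal of $R$, the left denominator set $S\in \mathrm{Den}_l(R,\mathfrak{a})$ respects the ideal structure of primes of $R$, and $S^{-1}\mathfrak{p}\in \mathrm{Spec}(S^{-1}R)$ for all $\mathfrak{p}\in \min(R,S)$. Then: 1. $1\leq |\min(R,S)|\leq |\min(R)|<\infty$, the set $$\min(S^{-1}R)=\min\{S^{-1}\mathfrak{p}\mid \mathfrak{p}\in \min(R,S)\}$$ is a finite set and $|\min(S^{-1}R)|\leq |\min(R,S)|<\infty$. 2. $\min(S^{-1}R)=\{S^{-1}\mathfrak{p}\mid \mathfrak{p}\in \min(R,S)\}$ if and only if the ideals $\{S^{-1}\mathfrak{p}\mid \mathfrak{p}\in \min(R,S)\}$ are incomparable. 3. If, in addition, for each prime ideal $\mathfrak{p}\in \min(R,S)$ the ideal $\sigma_S^{-1}(S^{-1}\mathfrak{p})$ of $R$ is a finitely generated right $R$-module (e.g. $R$ is a right Noetherian ring), then $$\min(S^{-1}R)=\{S^{-1}\mathfrak{p}\mid \mathfrak{p}\in \min(R,S)\},$$ where $\sigma_S:R\to S^{-1}R$, $r\mapsto \frac{r}{1}$.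
   Context: Rings are associative with $1$; "ideal" means two-sided ideal. A multiplicative subset $S$ of $R$ is a multiplicative subsemigroup with $1\in S$, $0\notin S$. It is a left Ore set if $Sr\cap Rs\neq\emptyset$ for all $r\in R$, $s\in S$; then $\mathrm{ass}_l(S)=\{r\in R\mid sr=0 \text{ for some } s\in S\}$ is an ideal. A left Ore set $S$ is a left denominator set if $rs=0$ with $r\in R$, $s\in S$ implies $tr=0$ for some $t\in S$. $\mathrm{Den}_l(R,\mathfrak{a})$ is the set of left denominator sets $S$ of $R$ with $\mathrm{ass}_l(S)=\mathfrak{a}$. For such $S$, $S^{-1}R=\{s^{-1}r\mid s\in S,r\in R\}$ is the left localization, and for a left ideal $I$ of $R$, $S^{-1}I=\{s^{-1}i\mid s\in S,i\in I\}$ is a left ideal of $S^{-1}R$ (in general not two-sided even if $I$ is). $\mathrm{Spec}(R)$ is the set of prime ideals of $R$ and $\min(R)$ the set of minimal primes of $R$; $\min(R,S)=\{\mathfrak{p}\in\min(R)\mid \mathfrak{p}\cap S=\emptyset\}$. For a set $X$ of ideals, $\min X$ denotes the set of minimal elements of $X$ with respect to inclusion. Ideals indexed by a set are incomparable if the ideals attached to distinct indices are not contained in one another. A ring is prime rich if each ideal contains a finite product of prime ideals that contain it. A left denominator set $S$ of $R$ respects the ideal structure of primes of $R$ if for each $\mathfrak{p}\in\mathrm{Spec}(R)$ the left ideal $S^{-1}\mathfrak{p}$ of $S^{-1}R$ is an ideal.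
   Formalization: In part 2, "incomparable" is taken for the set of ideals S^{-1}p (distinct members not contained in one another), not for the family indexed by p: distinct minimal primes p, q may have S^{-1}p = S^{-1}q, and then the "only if" direction of the indexed version fails. *)

theory Defs
  imports "HOL-Algebra.Algebra"
begin

text \<open>
  All rings are HOL-Algebra rings: associative, with unit, not assumed commutative. The library's
  \<^locale>\<open>ideal\<close> is a two-sided ideal.
\<close>

section \<open>Left denominator sets and left localization\<close>

definition multiplicative_subset :: "('a, 'm) ring_scheme \<Rightarrow> 'a set \<Rightarrow> bool" where
  "multiplicative_subset R S \<longleftrightarrow> submonoid S R \<and> \<zero>\<^bsub>R\<^esub> \<notin> S"

definition left_Ore_set :: "('a, 'm) ring_scheme \<Rightarrow> 'a set \<Rightarrow> bool" where
  "left_Ore_set R S \<longleftrightarrow> multiplicative_subset R S \<and>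
     (\<forall>r\<in>carrier R. \<forall>s\<in>S. (S #>\<^bsub>R\<^esub> r) \<inter> (carrier R #>\<^bsub>R\<^esub> s) \<noteq> {})"

definition left_ass :: "('a, 'm) ring_scheme \<Rightarrow> 'a set \<Rightarrow> 'a set" where
  "left_ass R S = {r \<in> carrier R. \<exists>s\<in>S. s \<otimes>\<^bsub>R\<^esub> r = \<zero>\<^bsub>R\<^esub>}"

definition left_denominator_set :: "('a, 'm) ring_scheme \<Rightarrow> 'a set \<Rightarrow> bool" where
  "left_denominator_set R S \<longleftrightarrow> left_Ore_set R S \<and>
     (\<forall>r\<in>carrier R. \<forall>s\<in>S. r \<otimes>\<^bsub>R\<^esub> s = \<zero>\<^bsub>R\<^esub> \<longrightarrow> (\<exists>t\<in>S. t \<otimes>\<^bsub>R\<^esub> r = \<zero>\<^bsub>R\<^esub>))"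

definition Den_l :: "('a, 'm) ring_scheme \<Rightarrow> 'a set \<Rightarrow> 'a set set" where
  "Den_l R \<aa> = {S. left_denominator_set R S \<and> left_ass R S = \<aa>}"

text \<open>
  A ring \<open>Q\<close> together with a map \<open>\<sigma>\<close> from \<open>R\<close> is the left localization of \<open>R\<close> at \<open>S\<close>, with
  \<open>\<sigma>\<close> the canonical map \<open>r \<mapsto> r/1\<close>. This is the textbook definition of the left ring of fractions:
  \<open>S\<close> becomes invertible, each element has the form \<open>s\<^sup>-\<^sup>1 r\<close>, and the kernel of \<open>\<sigma>\<close> is the left
  assassinator of \<open>S\<close>. For a left denominator set \<open>S\<close> the pair exists and is unique up to a
  unique isomorphism over \<open>R\<close>.
\<close>
definition left_localization ::
    "('a, 'm) ring_scheme \<Rightarrow> 'a set \<Rightarrow> ('b, 'n) ring_scheme \<Rightarrow> ('a \<Rightarrow> 'b) \<Rightarrow> bool" where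
  "left_localization R S Q \<sigma> \<longleftrightarrow>
     ring Q \<and> \<sigma> \<in> ring_hom R Q \<and> \<sigma> ` S \<subseteq> Units Q \<and>
     carrier Q = {inv\<^bsub>Q\<^esub> (\<sigma> s) \<otimes>\<^bsub>Q\<^esub> \<sigma> r | s r. s \<in> S \<and> r \<in> carrier R} \<and>
     a_kernel R Q \<sigma> = left_ass R S"

definition localized ::
    "'a set \<Rightarrow> ('b, 'n) ring_scheme \<Rightarrow> ('a \<Rightarrow> 'b) \<Rightarrow> 'a set \<Rightarrow> 'b set" where
  "localized S Q \<sigma> I = {inv\<^bsub>Q\<^esub> (\<sigma> s) \<otimes>\<^bsub>Q\<^esub> \<sigma> i | s i. s \<in> S \<and> i \<in> I}"


section \<open>Prime ideals\<close>

text \<open>The library's \<^locale>\<open>primeideal\<close> requires a commutative ring.\<close>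

definition prime_ideal :: "('a, 'm) ring_scheme \<Rightarrow> 'a set \<Rightarrow> bool" where
  "prime_ideal R P \<longleftrightarrow> ideal P R \<and> P \<noteq> carrier R \<and>
     (\<forall>I J. ideal I R \<longrightarrow> ideal J R \<longrightarrow> ideal_prod R I J \<subseteq> P \<longrightarrow> I \<subseteq> P \<or> J \<subseteq> P)"

definition Spec :: "('a, 'm) ring_scheme \<Rightarrow> 'a set set" where
  "Spec R = {P. prime_ideal R P}"

definition minimal_members :: "'a set set \<Rightarrow> 'a set set" where
  "minimal_members M = {I \<in> M. \<forall>J\<in>M. J \<subseteq> I \<longrightarrow> J = I}"

definition min_primes :: "('a, 'm) ring_scheme \<Rightarrow> 'a set set" where
  "min_primes R = minimal_members (Spec R)"

definition min_primes_avoiding :: "('a, 'm) ring_scheme \<Rightarrow> 'a set \<Rightarrow> 'a set set" where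
  "min_primes_avoiding R S = {P \<in> min_primes R. P \<inter> S = {}}"

text \<open>A set \<open>M\<close> of ideals is regarded as the family indexed by itself, that is
  \<open>incomparable_family (\<lambda>I. I) M\<close>.\<close>
definition incomparable_family :: "('i \<Rightarrow> 'a set) \<Rightarrow> 'i set \<Rightarrow> bool" where
  "incomparable_family F A \<longleftrightarrow> (\<forall>i\<in>A. \<forall>j\<in>A. i \<noteq> j \<longrightarrow> \<not> F i \<subseteq> F j)"

text \<open>The product of the empty list is the unit ideal. No prime contains the unit ideal, so it is
  the only product available for it, and it is contained in no proper ideal.\<close>
definition ideal_list_prod :: "('a, 'm) ring_scheme \<Rightarrow> 'a set list \<Rightarrow> 'a set" where
  "ideal_list_prod R Ps = foldr (ideal_prod R) Ps (carrier R)"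

definition prime_rich :: "('a, 'm) ring_scheme \<Rightarrow> bool" where
  "prime_rich R \<longleftrightarrow>
     (\<forall>I. ideal I R \<longrightarrow>
        (\<exists>Ps. (\<forall>P\<in>set Ps. prime_ideal R P \<and> I \<subseteq> P) \<and> ideal_list_prod R Ps \<subseteq> I))"

definition respects_primes ::
    "('a, 'm) ring_scheme \<Rightarrow> 'a set \<Rightarrow> ('b, 'n) ring_scheme \<Rightarrow> ('a \<Rightarrow> 'b) \<Rightarrow> bool" where
  "respects_primes R S Q \<sigma> \<longleftrightarrow> (\<forall>P\<in>Spec R. ideal (localized S Q \<sigma> P) Q)"


section \<open>Right modules inside \<open>R\<close>\<close>

definition right_ideal :: "('a, 'm) ring_scheme \<Rightarrow> 'a set \<Rightarrow> bool" where
  "right_ideal R J \<longleftrightarrow>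
     additive_subgroup J R \<and> (\<forall>a\<in>J. \<forall>r\<in>carrier R. a \<otimes>\<^bsub>R\<^esub> r \<in> J)"

definition fin_gen_right :: "('a, 'm) ring_scheme \<Rightarrow> 'a set \<Rightarrow> bool" where
  "fin_gen_right R J \<longleftrightarrow>
     (\<exists>G. finite G \<and> G \<subseteq> carrier R \<and>
          J = {\<Oplus>\<^bsub>R\<^esub>x\<in>G. x \<otimes>\<^bsub>R\<^esub> c x | c. c \<in> G \<rightarrow> carrier R})"

definition right_noetherian :: "('a, 'm) ring_scheme \<Rightarrow> bool" where
  "right_noetherian R \<longleftrightarrow> (\<forall>J. right_ideal R J \<longrightarrow> fin_gen_right R J)"

end

theory Submission
  imports Defs
begin

text \<open>
  A prime rich ring has finitely many minimal primes, and some product of them is zero. In the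
  localization the ideals \<open>S\<^sup>-\<^sup>1\<pp>\<close> of the factors again multiply to zero, so every prime of \<open>S\<^sup>-\<^sup>1R\<close>
  contains some \<open>S\<^sup>-\<^sup>1\<pp>\<close>, where \<open>\<pp>\<close> misses \<open>S\<close> because otherwise \<open>S\<^sup>-\<^sup>1\<pp>\<close> is the unit ideal. If the
  contraction \<open>\<pp>'\<close> of \<open>S\<^sup>-\<^sup>1\<pp>\<close> is finitely generated on the right, a single \<open>s \<in> S\<close> clears the
  denominators of all generators, so \<open>s\<pp>' \<subseteq> \<pp>\<close>, whence \<open>\<pp>' = \<pp>\<close> by primeness. Hence \<open>\<pp>\<close> is
  determined by \<open>S\<^sup>-\<^sup>1\<pp>\<close>, and incomparability of the minimal primes passes to the localization.
\<close>

section \<open>Ideals and primes tested on elements\<close>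

lemma (in ring) idealI_elementwise:
  assumes "I \<subseteq> carrier R" "\<zero> \<in> I"
    and "\<And>x y. x \<in> I \<Longrightarrow> y \<in> I \<Longrightarrow> x \<oplus> y \<in> I"
    and "\<And>x r. x \<in> I \<Longrightarrow> r \<in> carrier R \<Longrightarrow> r \<otimes> x \<in> I"
    and "\<And>x r. x \<in> I \<Longrightarrow> r \<in> carrier R \<Longrightarrow> x \<otimes> r \<in> I"
  shows "ideal I R"
proof (rule idealI[OF ring_axioms])
  have "\<ominus> x \<in> I" if "x \<in> I" for x
  proof -
    have "\<ominus> x = (\<ominus> \<one>) \<otimes> x" using that assms(1) by (simp add: l_minus subset_eq)
    then show ?thesis using assms(4)[OF that] by simp
  qed
  then show "subgroup I (add_monoid R)"
    using assms(1-3) by (auto simp: subgroup_def a_inv_def)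
qed (fact assms(4), fact assms(5))

lemma prime_ideal_imp_ideal: "prime_ideal R P \<Longrightarrow> ideal P R"
  by (simp add: prime_ideal_def)

text \<open>Primeness is a condition on products of ideals. In place of the ideals generated by
  \<open>x\<close> and \<open>y\<close>, the proof takes two annihilators modulo \<open>P\<close>:
  \<open>I\<close> is the left annihilator of all \<open>r \<otimes> y\<close>, and \<open>J\<close>
  is the right annihilator of \<open>I\<close>. Both are two-sided, their product lies in
  \<open>P\<close> by construction, and they contain \<open>x\<close> and \<open>y\<close>.\<close>

lemma (in ring) prime_ideal_elementwise:
  assumes P: "prime_ideal R P" and x: "x \<in> carrier R" and y: "y \<in> carrier R"
    and xy: "\<And>r. r \<in> carrier R \<Longrightarrow> x \<otimes> r \<otimes> y \<in> P"
  shows "x \<in> P \<or> y \<in> P"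
proof -
  interpret P: ideal P R using P by (rule prime_ideal_imp_ideal)
  define I where "I = {a \<in> carrier R. \<forall>r\<in>carrier R. a \<otimes> r \<otimes> y \<in> P}"
  define J where "J = {b \<in> carrier R. \<forall>a\<in>I. a \<otimes> b \<in> P}"
  have I: "ideal I R"
  proof (rule idealI_elementwise)
    fix a r assume a: "a \<in> I" and r: "r \<in> carrier R"
    show "r \<otimes> a \<in> I"
      using a r y P.I_l_closed by (auto simp: I_def m_assoc)
    have "a \<otimes> r \<otimes> t \<otimes> y \<in> P" if "t \<in> carrier R" for t
      using a r y that by (simp add: I_def m_assoc[of a r t])
    then show "a \<otimes> r \<in> I"
      using a r by (auto simp: I_def)
  qed (use y in \<open>auto simp: I_def l_distr\<close>)
  interpret I: ideal I R by (rule I)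
  have J: "ideal J R"
  proof (rule idealI_elementwise)
    fix b r assume b: "b \<in> J" and r: "r \<in> carrier R"
    show "b \<otimes> r \<in> J"
      using b r P.I_r_closed by (auto simp: J_def m_assoc[symmetric])
    have "a \<otimes> (r \<otimes> b) \<in> P" if "a \<in> I" for a
      using b r that I.I_r_closed[OF that r] by (simp add: J_def m_assoc[symmetric])
    then show "r \<otimes> b \<in> J"
      using b r by (auto simp: J_def)
  qed (auto simp: J_def r_distr)
  have "ideal_prod R I J \<subseteq> P"
  proof
    fix z assume "z \<in> ideal_prod R I J"
    then show "z \<in> P" by induction (auto simp: J_def)
  qed
  then have "I \<subseteq> P \<or> J \<subseteq> P"
    using P I J by (auto simp: prime_ideal_def)
  moreover have "x \<in> I" using x xy unfolding I_def by blast
  moreover have "y \<in> J"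
    unfolding J_def
  proof (intro CollectI conjI ballI y)
    fix a assume a: "a \<in> I"
    then have "a \<otimes> \<one> \<otimes> y \<in> P" unfolding I_def using one_closed by blast
    then show "a \<otimes> y \<in> P" using I.Icarr[OF a] by simp
  qed
  ultimately show ?thesis by blast
qed

section \<open>Finite products of ideals\<close>

lemma (in ring) ideal_list_prod_ideal:
  assumes "\<And>I. I \<in> set Is \<Longrightarrow> ideal I R"
  shows "ideal (ideal_list_prod R Is) R"
  using assms
  by (induction Is) (auto simp: ideal_list_prod_def oneideal ideal_prod_is_ideal)

lemma ideal_prod_mono:
  assumes "I \<subseteq> I'" "J \<subseteq> J'"
  shows "ideal_prod R I J \<subseteq> ideal_prod R I' J'"
proof
  fix z assume "z \<in> ideal_prod R I J"
  then show "z \<in> ideal_prod R I' J'"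
    using assms by induction (auto intro: ideal_prod.intros)
qed

lemma ideal_list_prod_map_mono:
  assumes "\<And>I. I \<in> set Is \<Longrightarrow> f I \<subseteq> I"
  shows "ideal_list_prod R (map f Is) \<subseteq> ideal_list_prod R Is"
  using assms
  by (induction Is) (simp_all add: ideal_list_prod_def ideal_prod_mono)

lemma (in ring) prime_ideal_list_prod:
  assumes P: "prime_ideal R P" and "\<And>I. I \<in> set Is \<Longrightarrow> ideal I R"
    and "ideal_list_prod R Is \<subseteq> P"
  shows "\<exists>I\<in>set Is. I \<subseteq> P"
  using assms(2,3)
proof (induction Is)
  case Nil
  then show ?case
    using P ideal.Icarr[OF prime_ideal_imp_ideal[OF P]]
    by (auto simp: ideal_list_prod_def prime_ideal_def)
next
  case (Cons I Is)
  then have "I \<subseteq> P \<or> ideal_list_prod R Is \<subseteq> P"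
    using P ideal_list_prod_ideal[of Is]
    by (auto simp: prime_ideal_def ideal_list_prod_def)
  then show ?case using Cons by auto
qed

section \<open>Minimal primes of a prime rich ring\<close>

lemma min_primes_prime: "P \<in> min_primes R \<Longrightarrow> prime_ideal R P"
  by (simp add: min_primes_def minimal_members_def Spec_def)

lemma min_primes_eqI: "P \<in> min_primes R \<Longrightarrow> prime_ideal R P' \<Longrightarrow> P' \<subseteq> P \<Longrightarrow> P' = P"
  by (auto simp: min_primes_def minimal_members_def Spec_def)

text \<open>Prime richness of the zero ideal gives a list of primes with zero product. Replacing
  each factor by a minimal prime below it keeps the product zero, and each minimal prime contains,
  hence equals, one of the new factors. The list thus also shows that there are finitely many
  minimal primes.\<close>

lemma (in ring) prime_rich_min_primes_prod:
  assumes "prime_rich R"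
  obtains Ms where "set Ms = min_primes R" "ideal_list_prod R Ms \<subseteq> {\<zero>}"
proof -
  obtain Ps where Ps: "\<And>P. P \<in> set Ps \<Longrightarrow> prime_ideal R P" "ideal_list_prod R Ps \<subseteq> {\<zero>}"
    using assms zeroideal unfolding prime_rich_def by blast
  have contains: "\<exists>I\<in>set Is. I \<subseteq> P"
    if "prime_ideal R P" "\<And>I. I \<in> set Is \<Longrightarrow> prime_ideal R I" "ideal_list_prod R Is \<subseteq> {\<zero>}" for P Is
  proof (rule prime_ideal_list_prod[OF that(1)])
    interpret ideal P R using that(1) by (rule prime_ideal_imp_ideal)
    show "ideal_list_prod R Is \<subseteq> P" using that(3) by auto
  qed (use that(2) prime_ideal_imp_ideal in blast)
  have "\<exists>M. M \<in> min_primes R \<and> M \<subseteq> P" if P: "prime_ideal R P" for P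
  proof -
    have "{N \<in> set Ps. N \<subseteq> P} \<noteq> {}" using contains[OF P Ps] by auto
    then obtain M where M: "M \<in> set Ps" "M \<subseteq> P"
      and min: "\<And>N. N \<in> set Ps \<Longrightarrow> N \<subseteq> P \<Longrightarrow> N \<subseteq> M \<Longrightarrow> N = M"
      using finite_has_minimal[of "{N \<in> set Ps. N \<subseteq> P}"] by force
    \<comment> \<open>\<open>N\<close> contains a member of \<open>Ps\<close>. That member lies
      below \<open>M\<close>, so it equals \<open>M\<close> by the choice of \<open>M\<close>, and
      \<open>M \<subseteq> N\<close> follows.\<close>
    have "N = M" if N: "prime_ideal R N" "N \<subseteq> M" for N
      using contains[OF N(1) Ps] min M N(2) by blast
    then have "M \<in> min_primes R"
      using M(1) Ps(1) by (auto simp: min_primes_def minimal_members_def Spec_def)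
    then show ?thesis using M(2) by blast
  qed
  then obtain f where f: "\<And>P. prime_ideal R P \<Longrightarrow> f P \<in> min_primes R"
      "\<And>P. prime_ideal R P \<Longrightarrow> f P \<subseteq> P"
    by metis
  let ?Ms = "map f Ps"
  have prod: "ideal_list_prod R ?Ms \<subseteq> {\<zero>}"
    using ideal_list_prod_map_mono[of Ps f R] Ps f(2) by blast
  have sub: "set ?Ms \<subseteq> min_primes R" using f(1) Ps(1) by auto
  have "P \<in> set ?Ms" if "P \<in> min_primes R" for P
    using contains[OF min_primes_prime[OF that] _ prod] sub min_primes_eqI[OF that]
    by (metis min_primes_prime subsetD)
  with sub have "set ?Ms = min_primes R" by blast
  with prod show ?thesis using that by blast
qed

text \<open>Picking an element of \<open>S\<close> in each factor and multiplying the picks gives a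
  common element. For the empty list it is the unit.\<close>

lemma submonoid_meets_ideal_list_prod:
  assumes "ring R" "submonoid S R" "\<And>I. I \<in> set Is \<Longrightarrow> I \<inter> S \<noteq> {}"
  shows "ideal_list_prod R Is \<inter> S \<noteq> {}"
proof -
  interpret submonoid S R by fact
  show ?thesis
    using assms(3)
  proof (induction Is)
    case Nil
    have "\<one>\<^bsub>R\<^esub> \<in> carrier R \<inter> S" using subset one_closed by blast
    then have "carrier R \<inter> S \<noteq> {}" by blast
    then show ?case by (simp add: ideal_list_prod_def)
  next
    case (Cons I Is)
    then obtain s t where "s \<in> I" "s \<in> S" "t \<in> ideal_list_prod R Is" "t \<in> S"
      by (metis disjoint_iff list.set_intros)
    then have "s \<otimes>\<^bsub>R\<^esub> t \<in> ideal_list_prod R (I # Is) \<inter> S"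
      by (auto simp: ideal_list_prod_def intro: ideal_prod.prod)
    then show ?case by blast
  qed
qed

text \<open>If every minimal prime met \<open>S\<close>, so would a zero product of minimal primes,
  which puts zero into \<open>S\<close>.\<close>

lemma (in ring) prime_rich_min_primes_avoiding_nonempty:
  assumes "prime_rich R" "multiplicative_subset R S"
  shows "min_primes_avoiding R S \<noteq> {}"
proof
  assume empty: "min_primes_avoiding R S = {}"
  obtain Ms where Ms: "set Ms = min_primes R" "ideal_list_prod R Ms \<subseteq> {\<zero>}"
    using prime_rich_min_primes_prod[OF assms(1)] .
  have "ideal_list_prod R Ms \<inter> S \<noteq> {}"
    by (rule submonoid_meets_ideal_list_prod[OF ring_axioms])
      (use assms(2) empty Ms(1) in \<open>auto simp: multiplicative_subset_def min_primes_avoiding_def\<close>)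
  then show False using assms(2) Ms(2) by (auto simp: multiplicative_subset_def)
qed

section \<open>Generators of right ideals\<close>

lemma fin_gen_right_generators:
  assumes "ring R" "fin_gen_right R J"
  obtains G where "finite G" "G \<subseteq> J" "G \<subseteq> carrier R"
    "J = {\<Oplus>\<^bsub>R\<^esub>x\<in>G. x \<otimes>\<^bsub>R\<^esub> c x | c. c \<in> G \<rightarrow> carrier R}"
proof -
  interpret ring R by fact
  obtain G where G: "finite G" "G \<subseteq> carrier R"
      "J = {\<Oplus>\<^bsub>R\<^esub>x\<in>G. x \<otimes>\<^bsub>R\<^esub> c x | c. c \<in> G \<rightarrow> carrier R}"
    using assms(2) unfolding fin_gen_right_def by blast
  have "G \<subseteq> J"
  proof
    fix y assume y: "y \<in> G"
    \<comment> \<open>\<open>fin_gen_right\<close> places \<open>G\<close> only in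
      \<open>carrier R\<close>. These coefficients exhibit the generator \<open>y\<close> itself as
      one of the combinations that make up \<open>J\<close>.\<close>
    define c where "c = (\<lambda>x. if y = x then \<one>\<^bsub>R\<^esub> else \<zero>\<^bsub>R\<^esub>)"
    have "(\<Oplus>\<^bsub>R\<^esub>x\<in>G. x \<otimes>\<^bsub>R\<^esub> c x) = (\<Oplus>\<^bsub>R\<^esub>x\<in>G. if y = x then x else \<zero>\<^bsub>R\<^esub>)"
      using G(2) y by (intro add.finprod_cong') (auto simp: c_def)
    also have "\<dots> = y"
      using add.finprod_singleton[of y G "\<lambda>x. x"] G(1,2) y by auto
    finally have "y = (\<Oplus>\<^bsub>R\<^esub>x\<in>G. x \<otimes>\<^bsub>R\<^esub> c x)" by (rule sym)
    moreover have "c \<in> G \<rightarrow> carrier R" by (simp add: c_def)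
    ultimately show "y \<in> J" unfolding G(3) by blast
  qed
  then show ?thesis by (rule that[OF G(1) _ G(2,3)])
qed

section \<open>Ideals and their left localizations\<close>

locale left_fractions = ring_hom_ring R Q \<sigma>
  for R (structure) and Q (structure) and \<sigma> +
  fixes S
  assumes multiplicative: "multiplicative_subset R S"
    and localization: "left_localization R S Q \<sigma>"
begin

sublocale denom: submonoid S R
  using multiplicative by (simp add: multiplicative_subset_def)

lemma denominator_carrier [simp]: "s \<in> S \<Longrightarrow> s \<in> carrier R"
  using denom.subset by blast

lemma denominator_unit: "s \<in> S \<Longrightarrow> \<sigma> s \<in> Units Q"
  using localization by (auto simp: left_localization_def)

lemma inv_denominator_carrier [simp]: "s \<in> S \<Longrightarrow> inv\<^bsub>Q\<^esub> (\<sigma> s) \<in> carrier Q"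
  using denominator_unit by simp

lemma localizedI: "s \<in> S \<Longrightarrow> i \<in> I \<Longrightarrow> inv\<^bsub>Q\<^esub> (\<sigma> s) \<otimes>\<^bsub>Q\<^esub> \<sigma> i \<in> localized S Q \<sigma> I"
  by (auto simp: localized_def)

lemma hom_localized:
  assumes "i \<in> I" "I \<subseteq> carrier R"
  shows "\<sigma> i \<in> localized S Q \<sigma> I"
proof -
  have "inv\<^bsub>Q\<^esub> (\<sigma> \<one>) \<otimes>\<^bsub>Q\<^esub> \<sigma> i = \<sigma> i" using assms by auto
  then show ?thesis using localizedI[OF denom.one_closed assms(1)] by simp
qed

lemma localized_eq_carrier:
  assumes "ideal (localized S Q \<sigma> I) Q" "I \<subseteq> carrier R" "I \<inter> S \<noteq> {}"
  shows "localized S Q \<sigma> I = carrier Q"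
proof -
  obtain s where s: "s \<in> I" "s \<in> S" using assms(3) by blast
  then have "\<one>\<^bsub>Q\<^esub> \<in> localized S Q \<sigma> I"
    using localizedI[OF s(2,1)] denominator_unit[OF s(2)] by simp
  then show ?thesis by (rule ideal.one_imp_carrier[OF assms(1)])
qed

text \<open>If \<sigma>(y) is the fraction i/s, then \<open>s \<otimes> y \<ominus> i\<close> is in
  the kernel of \<sigma>. The kernel is \<open>left_ass R S\<close>, so some \<open>t\<close> in
  \<open>S\<close> annihilates this difference from the left, and \<open>t \<otimes> s\<close> moves
  \<open>y\<close> into \<open>I\<close>.\<close>

lemma clear_denominator:
  assumes I: "ideal I R" and y: "y \<in> carrier R" "\<sigma> y \<in> localized S Q \<sigma> I"
  shows "\<exists>s\<in>S. s \<otimes> y \<in> I"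
proof -
  interpret I: ideal I R by (rule I)
  obtain s i where si: "s \<in> S" "i \<in> I" "\<sigma> y = inv\<^bsub>Q\<^esub> (\<sigma> s) \<otimes>\<^bsub>Q\<^esub> \<sigma> i"
    using y(2) by (auto simp: localized_def)
  have i: "i \<in> carrier R" using si(2) by (rule I.Icarr)
  have "\<sigma> (s \<otimes> y) = \<sigma> s \<otimes>\<^bsub>Q\<^esub> (inv\<^bsub>Q\<^esub> (\<sigma> s) \<otimes>\<^bsub>Q\<^esub> \<sigma> i)"
    using si y(1) by simp
  also have "\<dots> = \<sigma> i"
    using si i denominator_unit[OF si(1)] by (simp add: S.m_assoc[symmetric])
  finally have eq: "\<sigma> (s \<otimes> y) = \<sigma> i" .
  have sy: "s \<otimes> y \<in> carrier R" using si(1) y(1) by simp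
  have "\<sigma> (s \<otimes> y \<ominus> i) = \<sigma> (s \<otimes> y) \<ominus>\<^bsub>Q\<^esub> \<sigma> i"
    unfolding R.minus_eq S.minus_eq using sy i by (simp only: hom_add hom_a_inv R.a_inv_closed)
  also have "\<dots> = \<zero>\<^bsub>Q\<^esub>"
    unfolding eq using i by (simp only: S.r_right_minus_eq hom_closed)
  finally have "s \<otimes> y \<ominus> i \<in> a_kernel R Q \<sigma>"
    unfolding a_kernel_def' using sy i by blast
  then obtain t where t: "t \<in> S" "t \<otimes> (s \<otimes> y \<ominus> i) = \<zero>"
    using localization unfolding left_localization_def left_ass_def by blast
  then have tc: "t \<in> carrier R" by simp
  have "t \<otimes> (s \<otimes> y) \<ominus> t \<otimes> i = \<zero>"
    using t(2) unfolding R.minus_eq using tc sy i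
    by (simp only: R.r_distr R.r_minus R.a_inv_closed)
  then have "t \<otimes> (s \<otimes> y) = t \<otimes> i"
    using tc sy i by (simp only: R.r_right_minus_eq R.m_closed)
  then have "t \<otimes> s \<otimes> y = t \<otimes> i"
    using si(1) y(1) tc by (simp only: R.m_assoc denominator_carrier)
  then have "t \<otimes> s \<otimes> y \<in> I" using I.I_l_closed[OF si(2) tc] by (simp only:)
  then show ?thesis using denom.m_closed[OF t(1) si(1)] by blast
qed

lemma clear_denominators:
  assumes I: "ideal I R" and L: "ideal (localized S Q \<sigma> I) Q"
    and "finite G" "G \<subseteq> carrier R" "\<And>x. x \<in> G \<Longrightarrow> \<sigma> x \<in> localized S Q \<sigma> I"
  shows "\<exists>s\<in>S. \<forall>x\<in>G. s \<otimes> x \<in> I"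
  using assms(3-)
proof (induction G)
  case empty
  then show ?case using denom.one_closed by blast
next
  case (insert y G)
  interpret I: ideal I R by (rule I)
  interpret L: ideal "localized S Q \<sigma> I" Q by (rule L)
  obtain s where s: "s \<in> S" "\<And>x. x \<in> G \<Longrightarrow> s \<otimes> x \<in> I"
    using insert by auto
  \<comment> \<open>Clearing \<open>s \<otimes> y\<close> instead of \<open>y\<close> makes the
    single multiplier \<open>t \<otimes> s\<close> work for \<open>y\<close> and for the elements of
    \<open>G\<close> alike.\<close>
  have y: "y \<in> carrier R" and "\<sigma> (s \<otimes> y) \<in> localized S Q \<sigma> I"
    using insert.prems s(1) L.I_l_closed by auto
  then obtain t where t: "t \<in> S" "t \<otimes> (s \<otimes> y) \<in> I"
    using clear_denominator[OF I, of "s \<otimes> y"] s(1) by auto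
  have "t \<otimes> s \<otimes> x \<in> I" if "x \<in> insert y G" for x
  proof -
    have "x \<in> carrier R" using that insert.prems(1) by auto
    then have "t \<otimes> s \<otimes> x = t \<otimes> (s \<otimes> x)" using s(1) t(1) by (simp add: R.m_assoc)
    then show ?thesis using that t s I.I_l_closed by auto
  qed
  then show ?case using s(1) t(1) by blast
qed

text \<open>The product is tested only through images of elements of \<open>R\<close>, so products
  of localized ideals never have to be computed. If the first localized factor is not inside
  \<open>K\<close>, the elementwise criterion forces the image of the remaining product into
  \<open>K\<close>, and the induction continues.\<close>

lemma prime_contains_localized_factor:
  assumes K: "prime_ideal Q K"
    and Is: "\<And>I. I \<in> set Is \<Longrightarrow> ideal I R \<and> ideal (localized S Q \<sigma> I) Q"
    and "\<And>x. x \<in> ideal_list_prod R Is \<Longrightarrow> \<sigma> x \<in> K"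
  shows "\<exists>I\<in>set Is. localized S Q \<sigma> I \<subseteq> K"
  using assms(2,3)
proof (induction Is)
  case Nil
  then have "\<one>\<^bsub>Q\<^esub> \<in> K" by (metis R.one_closed foldr.simps(1) hom_one id_apply ideal_list_prod_def)
  then show ?case
    using K ideal.one_imp_carrier[of K Q] by (auto simp: prime_ideal_def)
next
  case (Cons I Is)
  interpret K: ideal K Q using K by (rule prime_ideal_imp_ideal)
  interpret I: ideal I R using Cons.prems(1) by auto
  interpret L: ideal "localized S Q \<sigma> I" Q using Cons.prems(1) by auto
  let ?J = "ideal_list_prod R Is"
  interpret J: ideal ?J R using R.ideal_list_prod_ideal[of Is] Cons.prems(1) by auto
  show ?case
  proof (cases "localized S Q \<sigma> I \<subseteq> K")
    case False
    then obtain z where z: "z \<in> localized S Q \<sigma> I" "z \<notin> K" by blast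
    have "\<sigma> j \<in> K" if j: "j \<in> ?J" for j
    proof -
      have "z \<otimes>\<^bsub>Q\<^esub> q \<otimes>\<^bsub>Q\<^esub> \<sigma> j \<in> K" if q: "q \<in> carrier Q" for q
      proof -
        \<comment> \<open>Closure of the localized ideal under right multiplication enters here: it
          rewrites \<open>z \<otimes> q\<close> as a fraction with numerator in \<open>I\<close>,
          next to which \<open>j\<close> can be multiplied inside \<open>R\<close>.\<close>
        obtain s i where si: "s \<in> S" "i \<in> I" "z \<otimes>\<^bsub>Q\<^esub> q = inv\<^bsub>Q\<^esub> (\<sigma> s) \<otimes>\<^bsub>Q\<^esub> \<sigma> i"
          using L.I_r_closed[OF z(1) q] by (auto simp: localized_def)
        have "i \<otimes> j \<in> ideal_list_prod R (I # Is)"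
          using si(2) j by (auto simp: ideal_list_prod_def intro: ideal_prod.prod)
        then have "\<sigma> (i \<otimes> j) \<in> K" by (rule Cons.prems(2))
        then have "inv\<^bsub>Q\<^esub> (\<sigma> s) \<otimes>\<^bsub>Q\<^esub> (\<sigma> i \<otimes>\<^bsub>Q\<^esub> \<sigma> j) \<in> K"
          using K.I_l_closed si(1,2) j by simp
        then show ?thesis
          using si j by (simp add: S.m_assoc)
      qed
      then show ?thesis
        using S.prime_ideal_elementwise[OF K, of z "\<sigma> j"] z j by auto
    qed
    then show ?thesis using Cons by auto
  qed auto
qed

text \<open>The zero product of minimal primes maps into every prime \<open>K\<close>, so the
  previous lemma supplies a factor. This is the coinitiality that identifies the minimal primes of
  \<open>Q\<close>.\<close>

lemma prime_contains_localized_min_prime: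
  assumes rich: "prime_rich R" and resp: "respects_primes R S Q \<sigma>" and K: "prime_ideal Q K"
  shows "\<exists>P\<in>min_primes_avoiding R S. localized S Q \<sigma> P \<subseteq> K"
proof -
  interpret K: ideal K Q using K by (rule prime_ideal_imp_ideal)
  obtain Ms where Ms: "set Ms = min_primes R" "ideal_list_prod R Ms \<subseteq> {\<zero>}"
    using R.prime_rich_min_primes_prod[OF rich] .
  have ideals: "ideal P R \<and> ideal (localized S Q \<sigma> P) Q" if "P \<in> set Ms" for P
    using that Ms(1) resp min_primes_prime[of P R] prime_ideal_imp_ideal[of R P]
    by (auto simp: respects_primes_def Spec_def)
  have "\<sigma> x \<in> K" if "x \<in> ideal_list_prod R Ms" for x
    using that Ms(2) by auto
  then obtain P where P: "P \<in> set Ms" "localized S Q \<sigma> P \<subseteq> K"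
    using prime_contains_localized_factor[OF K ideals] by blast
  have "P \<inter> S = {}"
  proof (rule ccontr)
    assume "P \<inter> S \<noteq> {}"
    then have "localized S Q \<sigma> P = carrier Q"
      using localized_eq_carrier ideals[OF P(1)] ideal.Icarr[of P R] by blast
    then show False using P(2) K K.Icarr by (auto simp: prime_ideal_def)
  qed
  then show ?thesis using P Ms(1) by (auto simp: min_primes_avoiding_def)
qed

lemma contraction_ideal:
  assumes "ideal L Q"
  shows "ideal {r \<in> carrier R. \<sigma> r \<in> L} R"
proof -
  interpret L: ideal L Q by fact
  show ?thesis
    by (rule R.idealI_elementwise) (auto intro: L.I_l_closed L.I_r_closed)
qed

lemma contraction_of_localized_prime:
  assumes P: "prime_ideal R P" "P \<inter> S = {}" and L: "ideal (localized S Q \<sigma> P) Q"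
    and fg: "fin_gen_right R {r \<in> carrier R. \<sigma> r \<in> localized S Q \<sigma> P}"
  shows "{r \<in> carrier R. \<sigma> r \<in> localized S Q \<sigma> P} = P" (is "?C = P")
proof
  interpret P: ideal P R using P(1) by (rule prime_ideal_imp_ideal)
  note C = contraction_ideal[OF L]
  obtain G where G: "finite G" "G \<subseteq> ?C" "G \<subseteq> carrier R"
      "?C = {\<Oplus>x\<in>G. x \<otimes> c x | c. c \<in> G \<rightarrow> carrier R}"
    using fin_gen_right_generators[OF R.ring_axioms fg] .
  have "\<exists>s\<in>S. \<forall>x\<in>G. s \<otimes> x \<in> P"
    by (rule clear_denominators[OF P.is_ideal L G(1,3)]) (use G(2) in blast)
  then obtain s where s: "s \<in> S" "\<And>x. x \<in> G \<Longrightarrow> s \<otimes> x \<in> P" by blast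
  \<comment> \<open>Generation on the right matters: the multiplier \<open>s\<close> acts on the
    left, reaches each generator directly, and the coefficient is absorbed by \<open>P\<close> on
    the right.\<close>
  have sum: "s \<otimes> (\<Oplus>x\<in>F. x \<otimes> c x) \<in> P" if "finite F" "F \<subseteq> G" "c \<in> G \<rightarrow> carrier R" for F c
    using that(1,2)
  proof (induction F)
    case (insert x F)
    then have xF: "x \<in> G" "F \<subseteq> G" by auto
    then have x: "x \<in> carrier R" "c x \<in> carrier R" and F: "(\<lambda>x. x \<otimes> c x) \<in> F \<rightarrow> carrier R"
      using G(3) that(3) by (blast, blast, blast)
    have "(\<Oplus>x\<in>insert x F. x \<otimes> c x) = x \<otimes> c x \<oplus> (\<Oplus>x\<in>F. x \<otimes> c x)"
      by (rule R.add.finprod_insert[OF insert.hyps F R.m_closed[OF x]])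
    then have "s \<otimes> (\<Oplus>x\<in>insert x F. x \<otimes> c x) = s \<otimes> x \<otimes> c x \<oplus> s \<otimes> (\<Oplus>x\<in>F. x \<otimes> c x)"
      using x s(1) R.finsum_closed[OF F] by (simp only: R.r_distr R.m_assoc R.m_closed denominator_carrier)
    moreover have "s \<otimes> x \<otimes> c x \<in> P" "s \<otimes> (\<Oplus>x\<in>F. x \<otimes> c x) \<in> P"
      using P.I_r_closed[OF s(2) x(2)] insert.IH xF by blast+
    ultimately show ?case by simp
  qed (use s(1) in simp)
  have sC: "s \<otimes> y \<in> P" if y: "y \<in> ?C" for y
  proof -
    obtain c where c: "c \<in> G \<rightarrow> carrier R" "y = (\<Oplus>x\<in>G. x \<otimes> c x)"
      using y unfolding G(4) by blast
    show ?thesis unfolding c(2) by (rule sum[OF G(1) subset_refl c(1)])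
  qed
  show "?C \<subseteq> P"
  proof
    fix y assume y: "y \<in> ?C"
    \<comment> \<open>\<open>?C\<close> also contains \<open>r \<otimes> y\<close>, so
      \<open>s\<close> sends it into \<open>P\<close>. Since \<open>s\<close> is not in
      \<open>P\<close>, primeness yields \<open>y\<close>.\<close>
    have "s \<otimes> r \<otimes> y \<in> P" if r: "r \<in> carrier R" for r
      using sC[OF ideal.I_l_closed[OF C y r]] s(1) r y by (simp add: R.m_assoc)
    then show "y \<in> P"
      using R.prime_ideal_elementwise[OF P(1), of s y] P(2) s(1) y by auto
  qed
  show "P \<subseteq> ?C" using hom_localized P.Icarr by blast
qed

end

section \<open>Minimal members of a family of sets\<close>

lemma minimal_members_eq_iff_incomparable:
  "minimal_members M = M \<longleftrightarrow> incomparable_family (\<lambda>I. I) M"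
  by (auto simp: minimal_members_def incomparable_family_def)

text \<open>A minimal member of \<open>N\<close> equals the member of \<open>M\<close> below it.
  Conversely, anything in \<open>N\<close> below a minimal member of \<open>M\<close> is squeezed
  between that member and another one of \<open>M\<close>. It is applied with \<open>Spec Q\<close>
  as \<open>N\<close>.\<close>

lemma minimal_members_coinitial:
  assumes "M \<subseteq> N" "\<And>J. J \<in> N \<Longrightarrow> \<exists>I\<in>M. I \<subseteq> J"
  shows "minimal_members N = minimal_members M"
proof (intro Set.set_eqI iffI)
  fix J assume J: "J \<in> minimal_members N"
  then have "J \<in> N" by (simp add: minimal_members_def)
  then obtain I where "I \<in> M" "I \<subseteq> J" using assms(2) by blast
  then have "J \<in> M" using J assms(1) unfolding minimal_members_def by blast
  then show "J \<in> minimal_members M" using J assms(1) by (auto simp: minimal_members_def)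
next
  fix I assume I: "I \<in> minimal_members M"
  have "J = I" if J: "J \<in> N" "J \<subseteq> I" for J
  proof -
    obtain I' where "I' \<in> M" "I' \<subseteq> J" using assms(2) J(1) by blast
    then show ?thesis using I J(2) unfolding minimal_members_def by blast
  qed
  then show "I \<in> minimal_members N" using I assms(1) by (auto simp: minimal_members_def)
qed

section \<open>Minimal primes of the localization\<close>

theorem proposition1p2:
  fixes R :: "('a, 'm) ring_scheme" and Q :: "('b, 'n) ring_scheme"
    and S \<aa> :: "'a set" and \<sigma> :: "'a \<Rightarrow> 'b"
  assumes "ring R"
    and "prime_rich R"
    and "ideal \<aa> R"
    and "S \<in> Den_l R \<aa>"
    and "left_localization R S Q \<sigma>"
    and "respects_primes R S Q \<sigma>"
    and "\<forall>\<pp> \<in> min_primes_avoiding R S. localized S Q \<sigma> \<pp> \<in> Spec Q"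
  shows
    "(1 \<le> card (min_primes_avoiding R S) \<and>
      card (min_primes_avoiding R S) \<le> card (min_primes R) \<and>
      finite (min_primes R) \<and>
      min_primes Q = minimal_members {localized S Q \<sigma> \<pp> | \<pp>. \<pp> \<in> min_primes_avoiding R S} \<and>
      finite (min_primes Q) \<and>
      card (min_primes Q) \<le> card (min_primes_avoiding R S) \<and>
      finite (min_primes_avoiding R S))
     \<and>
     (min_primes Q = {localized S Q \<sigma> \<pp> | \<pp>. \<pp> \<in> min_primes_avoiding R S} \<longleftrightarrow>
      incomparable_family (\<lambda>I. I) {localized S Q \<sigma> \<pp> | \<pp>. \<pp> \<in> min_primes_avoiding R S})
     \<and>
     ((\<forall>\<pp> \<in> min_primes_avoiding R S.
         fin_gen_right R {r \<in> carrier R. \<sigma> r \<in> localized S Q \<sigma> \<pp>}) \<longrightarrow>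
      min_primes Q = {localized S Q \<sigma> \<pp> | \<pp>. \<pp> \<in> min_primes_avoiding R S})
     \<and>
     (right_noetherian R \<longrightarrow>
      (\<forall>\<pp> \<in> min_primes_avoiding R S.
         fin_gen_right R {r \<in> carrier R. \<sigma> r \<in> localized S Q \<sigma> \<pp>}))"
proof -
  interpret R: ring R by fact
  interpret F: left_fractions R Q \<sigma> S
  proof -
    have "ring Q" "\<sigma> \<in> ring_hom R Q"
      using assms(5) by (auto simp: left_localization_def)
    then show "left_fractions R Q \<sigma> S"
      using assms(1,4,5) ring_hom_ringI2[of R Q \<sigma>]
      by (simp add: left_fractions_def left_fractions_axioms_def Den_l_def
          left_denominator_set_def left_Ore_set_def)
  qed
  let ?A = "min_primes_avoiding R S"
  let ?L = "localized S Q \<sigma>"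
  let ?M = "{?L \<pp> | \<pp>. \<pp> \<in> ?A}"
  have image: "?M = ?L ` ?A" by blast
  obtain Ms where Ms: "set Ms = min_primes R"
    using R.prime_rich_min_primes_prod[OF assms(2)] .
  have fin: "finite (min_primes R)" unfolding Ms[symmetric] by simp
  have sub: "?A \<subseteq> min_primes R" by (auto simp: min_primes_avoiding_def)
  have finA: "finite ?A" using finite_subset[OF sub fin] .
  have prime: "prime_ideal R \<pp>" and avoid: "\<pp> \<inter> S = {}" and L: "ideal (?L \<pp>) Q" if "\<pp> \<in> ?A" for \<pp>
    using that sub min_primes_prime[of \<pp> R] assms(6)
    by (auto simp: min_primes_avoiding_def respects_primes_def Spec_def)
  have min: "min_primes Q = minimal_members ?M"
    unfolding min_primes_def
  proof (rule minimal_members_coinitial)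
    show "?M \<subseteq> Spec Q" using assms(7) by auto
    fix K assume "K \<in> Spec Q"
    then obtain P where "P \<in> ?A" "?L P \<subseteq> K"
      using F.prime_contains_localized_min_prime[OF assms(2,6)] by (auto simp: Spec_def)
    then show "\<exists>I\<in>?M. I \<subseteq> K" by blast
  qed
  have subM: "min_primes Q \<subseteq> ?L ` ?A"
    using min image by (auto simp: minimal_members_def)
  have "?A \<noteq> {}"
    by (rule R.prime_rich_min_primes_avoiding_nonempty[OF assms(2) F.multiplicative])
  \<comment> \<open>\<open>card\<close> is zero on infinite sets, so \<open>finA\<close> is what
    turns nonemptiness into the lower bound.\<close>
  then have cards: "1 \<le> card ?A" "card ?A \<le> card (min_primes R)"
    using finA card_mono[OF fin sub] by (simp_all add: Suc_le_eq card_gt_0_iff)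
  have "finite (?L ` ?A)" using finA by simp
  then have cards_Q: "finite (min_primes Q)" "card (min_primes Q) \<le> card ?A"
    using finite_subset[OF subM] card_mono[OF _ subM] card_image_le[OF finA, of ?L] by simp_all
  have iff: "min_primes Q = ?M \<longleftrightarrow> incomparable_family (\<lambda>I. I) ?M"
    unfolding min by (rule minimal_members_eq_iff_incomparable)
  have fg: "min_primes Q = ?M"
    if fg: "\<forall>\<pp>\<in>?A. fin_gen_right R {r \<in> carrier R. \<sigma> r \<in> ?L \<pp>}"
  proof -
    have contr: "{r \<in> carrier R. \<sigma> r \<in> ?L \<pp>} = \<pp>" if "\<pp> \<in> ?A" for \<pp>
      using F.contraction_of_localized_prime[OF prime avoid L] fg that by blast
    \<comment> \<open>Contraction preserves inclusions and by \<open>contr\<close> recovers both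
      primes, so minimality of \<qq> applies.\<close>
    have "\<pp> = \<qq>" if "\<pp> \<in> ?A" "\<qq> \<in> ?A" "?L \<pp> \<subseteq> ?L \<qq>" for \<pp> \<qq>
    proof -
      have "\<pp> \<subseteq> \<qq>" using contr that by blast
      then show ?thesis using min_primes_eqI[of \<qq> R \<pp>] prime that sub by blast
    qed
    then show ?thesis unfolding iff incomparable_family_def by blast
  qed
  \<comment> \<open>The contraction of a two-sided ideal is two-sided, in particular a right
    ideal.\<close>
  have noeth: "fin_gen_right R {r \<in> carrier R. \<sigma> r \<in> ?L \<pp>}"
    if "right_noetherian R" "\<pp> \<in> ?A" for \<pp>
    using that F.contraction_ideal[OF L[OF that(2)]]
    by (simp add: right_noetherian_def right_ideal_def ideal_def ideal_axioms_def)
  show ?thesis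
    by (intro conjI impI ballI cards cards_Q fin finA min iff) (fact fg, fact noeth)
qed

end
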